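(* Let $\sigma\ge 0$ and let $M$ be a stochastic multi-armed bandit instance with finite action set $\mathcal{A}$, $|\mathcal{A}|=A$, mean rewards $r(a)\in[0,1]$, and conditionally $\sigma^2$-sub-Gaussian reward noise (see context). Run the bandit version of the algorithm EQO+ (see context) with $c_{1,t}=c_1$ for all $t$, for a constant $c_1>0$, and $c_{2,t}=\infty$ for all $t$ (so the bonus is $c_1/N^t(a)$). Then for every horizon $T\in\mathbb{N}$ and every $\delta\in(0,1]$, the distributional regret satisfies $$\mathrm{Reg}_M^{\mathrm{Alg}}(T,\delta)\le \frac{\sigma^2 T\log\frac{4}{\delta}}{c_1}+\frac{3}{2}c_1A+\sum_{a\in\mathcal{A}}\mathrm{gap}(a).$$
   Context: Bandit model: at each time $t=1,2,\dots$ the agent chooses $a_t\in\mathcal{A}$ and observes a reward $R_t$. Conditionally on the history $\mathcal{F}_{t-1}$ (all past actions and rewards) and on $a_t$, $R_t-r(a_t)$ has mean zero and is $\sigma^2$-sub-Gaussian: $\mathbb{E}[\exp(\lambda(R_t-r(a_t)))\mid \mathcal{F}_{t-1},a_t]\le \exp(\lambda^2\sigma^2/2)$ for all $\lambda\in\mathbb{R}$. Let $a^*\in\arg\max_a r(a)$, $\mathrm{gap}(a)=r(a^* )-r(a)$, and $\mathrm{Reg}_M^{\mathrm{Alg}}(T)=\sum_{t=1}^T (r(a^* )-r(a_t))$. The distributional regret is $\mathrm{Reg}_M^{\mathrm{Alg}}(T,\delta):=\inf\{x\in\mathbb{R}: \mathbb{P}(\mathrm{Reg}_M^{\mathrm{Alg}}(T)>x)\le\delta\}$.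 Bandit EQO+ with input sequences $\{(c_{1,t},c_{2,t})\}_{t\ge1}$, values in $(0,\infty]$: for $t=1,\dots,A$ it plays each arm once. For $t>A$ it sets $N^t(a)=\sum_{i<t}\mathbf{1}\{a_i=a\}$, $\hat r^t(a)=\frac{1}{N^t(a)}\sum_{i<t}R_i\mathbf{1}\{a_i=a\}$, $b^t(a)=\min\{c_{1,t}/N^t(a),\,c_{2,t}/\sqrt{N^t(a)}\}$ (a term with parameter $\infty$ is simply absent), and plays $a_t\in\arg\max_a(\hat r^t(a)+b^t(a))$ (ties broken arbitrarily). *)

theory Defs
  imports "HOL-Probability.Probability"
begin

text \<open>Time is indexed by t = 1, 2, ...; act t w is the arm played at time t,
  R t w the observed reward at time t, on the underlying probability space M.\<close>

text \<open>Generators of the sigma-algebra sigma(F_{t-1}, a_t): past actions a_1..a_t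
  (including the current one) and past rewards R_1..R_{t-1}.\<close>
definition hist_gen :: "'w measure \<Rightarrow> (nat \<Rightarrow> 'w \<Rightarrow> 'a) \<Rightarrow> (nat \<Rightarrow> 'w \<Rightarrow> real) \<Rightarrow> nat \<Rightarrow> 'w set set" where
  "hist_gen M act R t =
     {{w \<in> space M. act i w = x} | i x. 1 \<le> i \<and> i \<le> t}
   \<union> {{w \<in> space M. R i w \<in> B} | i B. 1 \<le> i \<and> i < t \<and> B \<in> sets borel}"

definition hist_alg :: "'w measure \<Rightarrow> (nat \<Rightarrow> 'w \<Rightarrow> 'a) \<Rightarrow> (nat \<Rightarrow> 'w \<Rightarrow> real) \<Rightarrow> nat \<Rightarrow> 'w measure" where
  "hist_alg M act R t = sigma (space M) (hist_gen M act R t)"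

text \<open>Conditional sigma^2-sub-Gaussianity of R_t - r(a_t) given (F_{t-1}, a_t):
  E[exp(l (R_t - r(a_t))) | F_{t-1}, a_t] \<le> exp(l^2 sigma^2/2) a.s., written in the
  defining form of conditional expectation of a nonnegative variable
  (integral over every conditioning event).\<close>
definition cond_subgaussian ::
  "'w measure \<Rightarrow> ('a \<Rightarrow> real) \<Rightarrow> real \<Rightarrow> (nat \<Rightarrow> 'w \<Rightarrow> 'a) \<Rightarrow> (nat \<Rightarrow> 'w \<Rightarrow> real) \<Rightarrow> bool" where
  "cond_subgaussian M r \<sigma> act R \<longleftrightarrow>
     (\<forall>t\<ge>1. \<forall>l::real. \<forall>B \<in> sets (hist_alg M act R t).
        (\<integral>\<^sup>+ w \<in> B. ennreal (exp (l * (R t w - r (act t w)))) \<partial>M)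
          \<le> ennreal (exp (l\<^sup>2 * \<sigma>\<^sup>2 / 2)) * emeasure M B)"

definition pulls :: "(nat \<Rightarrow> 'w \<Rightarrow> 'a) \<Rightarrow> nat \<Rightarrow> 'a \<Rightarrow> 'w \<Rightarrow> nat" where
  "pulls act t x w = card {i \<in> {1..<t}. act i w = x}"

definition emp_mean :: "(nat \<Rightarrow> 'w \<Rightarrow> 'a) \<Rightarrow> (nat \<Rightarrow> 'w \<Rightarrow> real) \<Rightarrow> nat \<Rightarrow> 'a \<Rightarrow> 'w \<Rightarrow> real" where
  "emp_mean act R t x w =
     (\<Sum>i\<in>{1..<t}. if act i w = x then R i w else 0) / real (pulls act t x w)"

text \<open>Optimistic index \<hat>r^t(a) + b^t(a), with
  b^t(a) = min (c_{1,t}/N, c_{2,t}/sqrt N); parameters in (0,\<infinity>], a parameter \<infinity>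
  makes its term \<infinity>, i.e. absent from the minimum.\<close>
definition eqo_index :: "(nat \<Rightarrow> ereal) \<Rightarrow> (nat \<Rightarrow> ereal) \<Rightarrow> (nat \<Rightarrow> 'w \<Rightarrow> 'a) \<Rightarrow> (nat \<Rightarrow> 'w \<Rightarrow> real)
    \<Rightarrow> nat \<Rightarrow> 'a \<Rightarrow> 'w \<Rightarrow> ereal" where
  "eqo_index c1 c2 act R t x w =
     ereal (emp_mean act R t x w)
     + min (c1 t / ereal (real (pulls act t x w)))
           (c2 t / ereal (sqrt (real (pulls act t x w))))"

definition eqo_plus_bandit :: "'w measure \<Rightarrow> (nat \<Rightarrow> ereal) \<Rightarrow> (nat \<Rightarrow> ereal)
    \<Rightarrow> (nat \<Rightarrow> 'w \<Rightarrow> 'a::finite) \<Rightarrow> (nat \<Rightarrow> 'w \<Rightarrow> real) \<Rightarrow> bool" where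
  "eqo_plus_bandit M c1 c2 act R \<longleftrightarrow>
     (\<forall>w \<in> space M.
        bij_betw (\<lambda>t. act t w) {1..CARD('a)} (UNIV :: 'a set) \<and>
        (\<forall>t > CARD('a). \<forall>x. eqo_index c1 c2 act R t x w \<le> eqo_index c1 c2 act R t (act t w) w))"

definition gap :: "('a::finite \<Rightarrow> real) \<Rightarrow> 'a \<Rightarrow> real" where
  "gap r x = Max (range r) - r x"

definition regret :: "('a::finite \<Rightarrow> real) \<Rightarrow> (nat \<Rightarrow> 'w \<Rightarrow> 'a) \<Rightarrow> nat \<Rightarrow> 'w \<Rightarrow> real" where
  "regret r act T w = (\<Sum>t\<in>{1..T}. gap r (act t w))"

text \<open>Distributional regret inf{x. P(Reg > x) \<le> delta}, taken in the extended reals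
  (it is -\<infinity> when the set is unbounded below).\<close>
definition dist_regret :: "'w measure \<Rightarrow> ('a::finite \<Rightarrow> real) \<Rightarrow> (nat \<Rightarrow> 'w \<Rightarrow> 'a) \<Rightarrow> nat \<Rightarrow> real \<Rightarrow> ereal" where
  "dist_regret M r act T \<delta> =
     Inf {ereal x | x. measure M {w \<in> space M. regret r act T w > x} \<le> \<delta>}"

end

theory Submission
  imports Defs
begin

text \<open>
  Write S_a for the sum of the noise observed on arm a during its first n pulls. The process
  V_a = exp (l S_a - l^2 sigma^2 n / 2) is a nonnegative supermartingale for every l.
  Applied to a single optimal arm with a negative l, it shows that the index of that arm never falls
  below r(a*) by more than a constant (quasi-optimism); no union bound over the arms is needed.

  At the last pull of a suboptimal arm a, quasi-optimism gives
  n gap(a) \<le> S_a + c1 + const * n, where n counts the earlier pulls. Summing over a leaves the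
  noise sums, from which the last pull of each arm is missing. The last pull is not a stopping
  time, so V_a is replaced by its running maximum U_a^2. The quantity U_a + V_a / U_a is a
  supermartingale that starts at 2 and dominates U_a, which makes the product of the U_a over the
  k suboptimal arms at most 2^k in expectation. For exp (l c1) = 8 (1 + delta) / delta \<ge> 16 the
  resulting term 2 k log 2 / l is at most c1 k / 2.

  The two failure events are not joined by a union bound, which is too weak for delta near 1: with
  failure probabilities p1 and p2 the potential 1 - (1 - p1) (1 - p2) is a supermartingale as long
  as both factors are positive, since each round changes only one of the two. The choice
  p1 = delta (1 + delta) / 2, p2 \<le> delta / (4 (1 + delta)) keeps it below delta.
\<close>

subsection \<open>Exponential supermartingales\<close>

text \<open>The hypothesis on events says that \<open>density M g\<close>, restricted to
  \<open>H\<close>, is dominated by \<open>M\<close>, so monotonicity of the integral in the measure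
  covers all \<open>H\<close>-measurable integrands at once. This turns the eventwise form of a
  conditional bound into a one-step supermartingale inequality.\<close>

lemma nn_integral_mult_le_if_subalgebra:
  assumes sub: "subalgebra M H"
    and g [measurable]: "g \<in> borel_measurable M"
    and le: "\<And>B. B \<in> sets H \<Longrightarrow> (\<integral>\<^sup>+ w \<in> B. g w \<partial>M) \<le> emeasure M B"
    and f: "f \<in> borel_measurable H"
  shows "(\<integral>\<^sup>+ w. g w * f w \<partial>M) \<le> (\<integral>\<^sup>+ w. f w \<partial>M)"
proof -
  have sub': "subalgebra (density M g) H"
    using sub by (simp add: subalgebra_def)
  have fM [measurable]: "f \<in> borel_measurable M"
    using measurable_from_subalg[OF sub f] .
  have "restr_to_subalg (density M g) H \<le> restr_to_subalg M H"
  proof (subst le_measure)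
    show "sets (restr_to_subalg (density M g) H) = sets (restr_to_subalg M H)"
      by (simp add: sets_restr_to_subalg[OF sub] sets_restr_to_subalg[OF sub'])
    show "\<forall>B\<in>sets (restr_to_subalg (density M g) H).
      emeasure (restr_to_subalg (density M g) H) B \<le> emeasure (restr_to_subalg M H) B"
    proof
      fix B assume "B \<in> sets (restr_to_subalg (density M g) H)"
      then have "B \<in> sets H" by (simp add: sets_restr_to_subalg[OF sub'])
      moreover from this have "B \<in> sets M" using sub by (auto simp: subalgebra_def)
      ultimately show "emeasure (restr_to_subalg (density M g) H) B \<le> emeasure (restr_to_subalg M H) B"
        using le[of B]
        by (simp add: emeasure_restr_to_subalg[OF sub] emeasure_restr_to_subalg[OF sub'] emeasure_density)
    qed
  qed
  then have "(\<integral>\<^sup>+ w. f w \<partial>restr_to_subalg (density M g) H) \<le> (\<integral>\<^sup>+ w. f w \<partial>restr_to_subalg M H)"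
    by (intro nn_integral_mono_measure)
      (auto simp: sets_restr_to_subalg[OF sub] sets_restr_to_subalg[OF sub'])
  then show ?thesis
    by (simp add: nn_integral_subalgebra2[OF sub f] nn_integral_subalgebra2[OF sub' f] nn_integral_density)
qed

section \<open>Noise sums, exponential processes and their running maxima\<close>

definition noise_sum ::
    "('a \<Rightarrow> real) \<Rightarrow> (nat \<Rightarrow> 'w \<Rightarrow> 'a) \<Rightarrow> (nat \<Rightarrow> 'w \<Rightarrow> real) \<Rightarrow> nat \<Rightarrow> 'a \<Rightarrow> 'w \<Rightarrow> real" where
  "noise_sum r act R t x w = (\<Sum>i\<in>{1..<t}. if act i w = x then R i w - r x else 0)"

definition exp_mart ::
    "('a \<Rightarrow> real) \<Rightarrow> real \<Rightarrow> (nat \<Rightarrow> 'w \<Rightarrow> 'a) \<Rightarrow> (nat \<Rightarrow> 'w \<Rightarrow> real) \<Rightarrow> real \<Rightarrow> nat \<Rightarrow> 'a \<Rightarrow> 'w \<Rightarrow> real" where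
  "exp_mart r \<sigma> act R l t x w =
     exp (l * noise_sum r act R t x w - l\<^sup>2 * \<sigma>\<^sup>2 / 2 * real (pulls act t x w))"

text \<open>The square root of the running maximum, i.e. the exponent 1/2 of the Chernoff bound.\<close>

primrec peak ::
    "('a \<Rightarrow> real) \<Rightarrow> real \<Rightarrow> (nat \<Rightarrow> 'w \<Rightarrow> 'a) \<Rightarrow> (nat \<Rightarrow> 'w \<Rightarrow> real) \<Rightarrow> real \<Rightarrow> nat \<Rightarrow> 'a \<Rightarrow> 'w \<Rightarrow> real" where
  "peak r \<sigma> act R l 0 x w = 1"
| "peak r \<sigma> act R l (Suc t) x w =
     max (peak r \<sigma> act R l t x w) (sqrt (exp_mart r \<sigma> act R l (Suc t) x w))"

lemma noise_sum_Suc: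
  assumes "t \<ge> 1"
  shows "noise_sum r act R (Suc t) x w =
    noise_sum r act R t x w + (if act t w = x then R t w - r x else 0)"
  using assms by (simp add: noise_sum_def)

lemma pulls_Suc:
  assumes "t \<ge> 1"
  shows "pulls act (Suc t) x w = pulls act t x w + (if act t w = x then 1 else 0)"
proof -
  have "{i \<in> {1..<Suc t}. act i w = x} =
    (if act t w = x then insert t {i \<in> {1..<t}. act i w = x} else {i \<in> {1..<t}. act i w = x})"
    using assms by (auto simp: less_Suc_eq)
  then show ?thesis by (simp add: pulls_def)
qed

lemma exp_mart_Suc:
  assumes "t \<ge> 1"
  shows "exp_mart r \<sigma> act R l (Suc t) x w = exp_mart r \<sigma> act R l t x w *
    (if act t w = x then exp (l * (R t w - r (act t w)) - l\<^sup>2 * \<sigma>\<^sup>2 / 2) else 1)"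
  using assms
  by (auto simp: exp_mart_def noise_sum_Suc pulls_Suc exp_add[symmetric] exp_diff[symmetric] algebra_simps)

lemma exp_mart_pos: "exp_mart r \<sigma> act R l t x w > 0"
  by (simp add: exp_mart_def)

lemma peak_ge_1: "peak r \<sigma> act R l t x w \<ge> 1"
  by (induction t) auto

lemma peak_pos: "peak r \<sigma> act R l t x w > 0"
  using peak_ge_1[of r \<sigma> act R l t x w] by linarith

lemmas potential_simps [simp] =
  exp_mart_pos less_imp_le[OF exp_mart_pos] less_imp_neq[OF exp_mart_pos, symmetric]
  peak_pos less_imp_le[OF peak_pos] less_imp_neq[OF peak_pos, symmetric]

lemma sqrt_exp_mart_le_peak:
  assumes "s \<le> t"
  shows "sqrt (exp_mart r \<sigma> act R l s x w) \<le> peak r \<sigma> act R l t x w"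
  using assms
proof (induction t)
  case 0
  then show ?case by (simp add: exp_mart_def noise_sum_def pulls_def)
next
  case (Suc t)
  then show ?case by (cases "s = Suc t") (auto simp: le_Suc_eq max.coboundedI1)
qed

text \<open>Without a pull of \<open>x\<close> the process keeps its value, which the running
  maximum already includes.\<close>

lemma peak_Suc_eq:
  assumes "t \<ge> 1" "act t w \<noteq> x"
  shows "peak r \<sigma> act R l (Suc t) x w = peak r \<sigma> act R l t x w"
  using assms sqrt_exp_mart_le_peak[of t t r \<sigma> act R l x w] by (simp add: exp_mart_Suc)

text \<open>If \<open>sqrt v\<close> exceeds \<open>u\<close>, the left side is
  \<open>2 * sqrt v\<close> and the claim is the AM-GM inequality. Updating the maximum thus never
  raises \<open>u + v / u\<close>, and a new value \<open>v\<close> enters only linearly.\<close>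

lemma max_sqrt_potential_le:
  fixes u v :: real
  assumes "u > 0" "v \<ge> 0"
  shows "max u (sqrt v) + v / max u (sqrt v) \<le> u + v / u"
proof (cases "sqrt v \<le> u")
  case True
  then show ?thesis by (simp add: max_def)
next
  case False
  then have "max u (sqrt v) = sqrt v" by simp
  moreover have "v / sqrt v = sqrt v" using assms by (simp add: real_div_sqrt)
  moreover have "2 * sqrt v \<le> u + v / u"
  proof -
    have "0 \<le> (u - sqrt v)\<^sup>2" by simp
    then have "2 * sqrt v * u \<le> u * u + v" 
      using assms by (simp add: power2_diff power2_eq_square[of u] mult.commute mult.left_commute)
    then show ?thesis using assms by (simp add: field_simps)
  qed
  ultimately show ?thesis by simp
qed

section \<open>Measurability with respect to the history and the one-step inequality\<close>

locale subgaussian_bandit = prob_space M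
  for M :: "'w measure" +
  fixes r :: "'a::finite \<Rightarrow> real" and \<sigma> :: real
    and act :: "nat \<Rightarrow> 'w \<Rightarrow> 'a" and R :: "nat \<Rightarrow> 'w \<Rightarrow> real"
  assumes act_measurable: "\<And>t. act t \<in> measurable M (count_space UNIV)"
    and R_measurable: "\<And>t. R t \<in> borel_measurable M"
    and subgaussian: "cond_subgaussian M r \<sigma> act R"
begin

abbreviation "H \<equiv> hist_alg M act R"
abbreviation "V \<equiv> exp_mart r \<sigma> act R"
abbreviation "U \<equiv> peak r \<sigma> act R"

lemma hist_gen_sets: "hist_gen M act R t \<subseteq> sets M"
proof -
  have "{w \<in> space M. act i w = x} \<in> sets M" for i x
    using measurable_sets[OF act_measurable[of i], of "{x}"] by (simp add: vimage_def Int_def conj_commute)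
  moreover have "{w \<in> space M. R i w \<in> B} \<in> sets M" if "B \<in> sets borel" for i B
    using measurable_sets[OF R_measurable[of i], of B] that by (simp add: vimage_def Int_def conj_commute)
  ultimately show ?thesis by (auto simp: hist_gen_def)
qed

lemma space_H: "space (H t) = space M"
  by (simp add: hist_alg_def space_measure_of_conv)

lemma sets_H: "sets (H t) = sigma_sets (space M) (hist_gen M act R t)"
  using hist_gen_sets sets.space_closed unfolding hist_alg_def
  by (subst sets_measure_of) blast+

lemma subalgebra_H: "subalgebra M (H t)"
  using sets.sigma_sets_subset[OF hist_gen_sets] by (simp add: subalgebra_def space_H sets_H)

lemma act_measurable_H:
  assumes "1 \<le> i" "i \<le> t"
  shows "act i \<in> measurable (H t) (count_space UNIV)"
proof -
  have "act i -` {x} \<inter> space M \<in> sets (H t)" for x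
  proof -
    have "{w \<in> space M. act i w = x} \<in> hist_gen M act R t"
      using assms by (auto simp: hist_gen_def)
    then show ?thesis
      by (auto simp: sets_H vimage_def Int_def conj_commute)
  qed
  then show ?thesis by (simp add: measurable_count_space_eq2 space_H)
qed

lemma R_measurable_H:
  assumes "1 \<le> i" "i < t"
  shows "R i \<in> borel_measurable (H t)"
proof (rule measurableI)
  fix B :: "real set" assume "B \<in> sets borel"
  then have "{w \<in> space M. R i w \<in> B} \<in> hist_gen M act R t"
    using assms unfolding hist_gen_def by blast
  then show "R i -` B \<inter> space (H t) \<in> sets (H t)"
    by (auto simp: sets_H space_H vimage_def Int_def conj_commute)
qed simp

lemma V_measurable_H:
  assumes "s \<le> t"
  shows "V l s x \<in> borel_measurable (H t)"
proof -
  have [measurable]: "act i \<in> measurable (H t) (count_space UNIV)" "R i \<in> borel_measurable (H t)"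
    if "i \<in> {1..<s}" for i
    using that assms by (auto intro!: act_measurable_H R_measurable_H)
  have [measurable]: "noise_sum r act R s x \<in> borel_measurable (H t)"
    unfolding noise_sum_def[abs_def] by measurable
  have pulls_eq: "real (pulls act s x w) = (\<Sum>i\<in>{1..<s}. if act i w = x then 1 else 0)" for w
    by (simp add: pulls_def sum.If_cases Int_def)
  have [measurable]: "(\<lambda>w. real (pulls act s x w)) \<in> borel_measurable (H t)"
    unfolding pulls_eq by measurable
  show ?thesis
    unfolding exp_mart_def[abs_def] by measurable
qed

lemma U_measurable_H:
  assumes "s \<le> t"
  shows "U l s x \<in> borel_measurable (H t)"
  using assms
proof (induction s)
  case 0
  have "U l 0 x = (\<lambda>_. 1)" by auto
  then show ?case by simp
next
  case (Suc s)
  have [measurable]: "U l s x \<in> borel_measurable (H t)" "V l (Suc s) x \<in> borel_measurable (H t)"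
    using Suc V_measurable_H by auto
  show ?case by simp
qed

text \<open>The factor gained at time \<open>t\<close> by the process of whichever arm is played.
  Centring at \<open>r (act t w)\<close> lets one factor serve all arms.\<close>

definition incr where "incr l t w = exp (l * (R t w - r (act t w)) - l\<^sup>2 * \<sigma>\<^sup>2 / 2)"

lemma incr_measurable [measurable]: "incr l t \<in> borel_measurable M"
proof -
  note [measurable] = act_measurable[of t] R_measurable[of t]
  have [measurable]: "(\<lambda>w. r (act t w)) \<in> borel_measurable M"
    by measurable
  show ?thesis unfolding incr_def[abs_def] by measurable
qed

text \<open>The conditional mean of \<open>incr l t\<close> given the past and the current action is
  at most 1: this is the sub-Gaussian bound divided by its constant, tested against variables known
  before \<open>R t\<close> is seen.\<close>

lemma nn_integral_incr_le:
  assumes "t \<ge> 1" and f: "f \<in> borel_measurable (H t)"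
  shows "(\<integral>\<^sup>+ w. ennreal (incr l t w) * f w \<partial>M) \<le> (\<integral>\<^sup>+ w. f w \<partial>M)"
proof (rule nn_integral_mult_le_if_subalgebra[OF subalgebra_H _ _ f])
  fix B assume B: "B \<in> sets (H t)"
  then have BM [measurable]: "B \<in> sets M" using subalgebra_H by (auto simp: subalgebra_def)
  let ?c = "exp (l\<^sup>2 * \<sigma>\<^sup>2 / 2)"
  note [measurable] = act_measurable[of t] R_measurable[of t]
  have [measurable]: "(\<lambda>w. r (act t w)) \<in> borel_measurable M"
    by measurable
  have "(\<integral>\<^sup>+ w \<in> B. ennreal (incr l t w) \<partial>M)
      = (\<integral>\<^sup>+ w. ennreal (1 / ?c) * (ennreal (exp (l * (R t w - r (act t w)))) * indicator B w) \<partial>M)"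
    by (intro nn_integral_cong)
      (auto simp: incr_def exp_diff ennreal_mult'[symmetric] indicator_def)
  also have "\<dots> = ennreal (1 / ?c) * (\<integral>\<^sup>+ w \<in> B. ennreal (exp (l * (R t w - r (act t w)))) \<partial>M)"
    by (rule nn_integral_cmult) measurable
  also have "\<dots> \<le> ennreal (1 / ?c) * (ennreal ?c * emeasure M B)"
    using subgaussian B assms(1) by (intro mult_left_mono) (auto simp: cond_subgaussian_def)
  also have "\<dots> = emeasure M B"
    by (simp add: mult.assoc[symmetric] ennreal_mult'[symmetric])
  finally show "(\<integral>\<^sup>+ w \<in> B. ennreal (incr l t w) \<partial>M) \<le> emeasure M B" .
qed simp

section \<open>The failure potential and its expectation\<close>

context
  fixes y :: 'a and l\<^sub>1 l\<^sub>2 p q :: real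
  assumes p_pos: "p > 0" and q_pos: "q > 0"
begin

text \<open>The arm \<open>y\<close> will be an optimal one. The exponent is negative because only
  underestimation of \<open>y\<close> does harm, and \<open>p\<close> normalises failure to the
  level 1.\<close>

definition opt_pot where "opt_pot t w = p * V (- l\<^sub>1) t y w"

definition arm_pot where "arm_pot t x w = U l\<^sub>2 t x w + V l\<^sub>2 t x w / U l\<^sub>2 t x w"

text \<open>One product for all other arms, since only the sum of the logarithms of their maxima
  enters the regret bound.\<close>

definition sub_pot where "sub_pot t w = q * (\<Prod>x\<in>UNIV - {y}. arm_pot t x w)"

definition good where "good t w \<longleftrightarrow> (\<forall>s\<in>{1..t}. opt_pot s w < 1 \<and> sub_pot s w < 1)"

text \<open>\<open>good\<close> refers to all times up to \<open>t\<close>, so a failure is never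
  undone. The value is frozen at 1 from the first failure on and therefore dominates the indicator
  of failure.\<close>

definition fail_pot where
  "fail_pot t w = (if good t w then 1 - (1 - opt_pot t w) * (1 - sub_pot t w) else 1)"

text \<open>Together with \<open>sub_weight\<close>, this is the part of \<open>fail_pot\<close>
  that the next reward multiplies by \<open>incr\<close>; it is known once the arm is
  chosen.\<close>

definition opt_weight where
  "opt_weight t w = (if good t w \<and> act t w = y then (1 - sub_pot t w) * opt_pot t w else 0)"

definition sub_weight where
  "sub_weight t w = (if good t w \<and> act t w \<noteq> y
     then (1 - opt_pot t w) * (sub_pot t w * (V l\<^sub>2 t (act t w) w / U l\<^sub>2 t (act t w) w) / arm_pot t (act t w) w)
     else 0)"

lemma arm_pot_pos: "arm_pot t x w > 0"
  unfolding arm_pot_def by (intro add_pos_pos divide_pos_pos peak_pos exp_mart_pos)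

lemma opt_pot_pos: "opt_pot t w > 0"
  using p_pos by (simp add: opt_pot_def exp_mart_pos)

lemma sub_pot_pos: "sub_pot t w > 0"
  using q_pos by (auto simp: sub_pot_def intro!: mult_pos_pos prod_pos arm_pot_pos)

lemma arm_pot_Suc_le:
  assumes "t \<ge> 1" "act t w = x"
  shows "arm_pot (Suc t) x w \<le> U l\<^sub>2 t x w + V l\<^sub>2 t x w * incr l\<^sub>2 t w / U l\<^sub>2 t x w"
proof -
  have "V l\<^sub>2 (Suc t) x w = V l\<^sub>2 t x w * incr l\<^sub>2 t w"
    using assms by (simp add: exp_mart_Suc incr_def)
  then show ?thesis
    using max_sqrt_potential_le[of "U l\<^sub>2 t x w" "V l\<^sub>2 (Suc t) x w"]
    by (simp add: arm_pot_def incr_def)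
qed

lemma arm_pot_Suc_eq:
  assumes "t \<ge> 1" "act t w \<noteq> x"
  shows "arm_pot (Suc t) x w = arm_pot t x w"
  using assms by (simp add: arm_pot_def peak_Suc_eq exp_mart_Suc del: peak.simps)

lemma opt_pot_Suc:
  assumes "t \<ge> 1"
  shows "opt_pot (Suc t) w = opt_pot t w * (if act t w = y then incr (- l\<^sub>1) t w else 1)"
  using assms by (simp add: opt_pot_def exp_mart_Suc incr_def)

lemma sub_pot_Suc_eq:
  assumes "t \<ge> 1" "act t w = y"
  shows "sub_pot (Suc t) w = sub_pot t w"
  using assms unfolding sub_pot_def by (intro arg_cong2[where f = "(*)"] prod.cong arm_pot_Suc_eq) auto

text \<open>Only the factor of the pulled arm changes. In that factor, of the form
  \<open>u + v / u\<close>, only the share \<open>v / u\<close> is multiplied by the increment, the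
  update of the maximum being free.\<close>

lemma sub_pot_Suc_le:
  assumes "t \<ge> 1" "act t w = x" "x \<noteq> y"
  shows "sub_pot (Suc t) w \<le> sub_pot t w
    + sub_pot t w * (V l\<^sub>2 t x w / U l\<^sub>2 t x w) / arm_pot t x w * (incr l\<^sub>2 t w - 1)"
proof -
  define P where "P = q * (\<Prod>z\<in>UNIV - {y} - {x}. arm_pot t z w)"
  have P: "P > 0" unfolding P_def
    using q_pos by (auto intro!: mult_pos_pos prod_pos arm_pot_pos)
  have *: "(\<Prod>z\<in>UNIV - {y}. f z) = f x * (\<Prod>z\<in>UNIV - {y} - {x}. f z)" for f :: "'a \<Rightarrow> real"
    using assms by (intro prod.remove) auto
  have "(\<Prod>z\<in>UNIV - {y} - {x}. arm_pot (Suc t) z w) = (\<Prod>z\<in>UNIV - {y} - {x}. arm_pot t z w)"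
    using assms by (intro prod.cong arm_pot_Suc_eq) auto
  then have "sub_pot (Suc t) w = P * arm_pot (Suc t) x w"
    unfolding sub_pot_def P_def * by simp
  also have "\<dots> \<le> P * (U l\<^sub>2 t x w + V l\<^sub>2 t x w * incr l\<^sub>2 t w / U l\<^sub>2 t x w)"
    using P assms by (intro mult_left_mono arm_pot_Suc_le) auto
  also have "\<dots> = P * arm_pot t x w + P * (V l\<^sub>2 t x w / U l\<^sub>2 t x w) * (incr l\<^sub>2 t w - 1)"
    by (simp add: arm_pot_def algebra_simps diff_divide_distrib)
  also have "P * arm_pot t x w = sub_pot t w"
    unfolding sub_pot_def P_def * by simp
  also have "P = sub_pot t w / arm_pot t x w"
    using arm_pot_pos[of t x w] unfolding sub_pot_def P_def * by simp
  finally show ?thesis by (simp add: mult.commute)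
qed

lemma good_Suc: "good (Suc t) w \<longleftrightarrow> good t w \<and> opt_pot (Suc t) w < 1 \<and> sub_pot (Suc t) w < 1"
  unfolding good_def by (auto simp: atLeastAtMostSuc_conv)

lemma goodD:
  assumes "good t w" "1 \<le> s" "s \<le> t"
  shows "opt_pot s w < 1" "sub_pot s w < 1"
  using assms by (auto simp: good_def)

lemma sub_weight_frac:
  "V l\<^sub>2 t x w / U l\<^sub>2 t x w / arm_pot t x w \<in> {0..1}"
  using peak_pos[of r \<sigma> act R l\<^sub>2 t x w] exp_mart_pos[of r \<sigma> act R l\<^sub>2 t x w] arm_pot_pos[of t x w]
  by (simp add: arm_pot_def divide_simps)

lemma weights_nonneg:
  assumes "t \<ge> 1"
  shows "opt_weight t w \<ge> 0" "sub_weight t w \<ge> 0" "opt_weight t w + sub_weight t w \<le> fail_pot t w"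
proof -
  show "opt_weight t w \<ge> 0"
    using goodD[of t w t] assms opt_pot_pos[of t w] by (auto simp: opt_weight_def)
  show "sub_weight t w \<ge> 0"
    using goodD[of t w t] assms sub_pot_pos[of t w] arm_pot_pos
    by (auto simp: sub_weight_def less_imp_le intro!: mult_nonneg_nonneg divide_nonneg_pos mult_pos_pos)
  show "opt_weight t w + sub_weight t w \<le> fail_pot t w"
  proof (cases "good t w")
    case True
    define c where "c = V l\<^sub>2 t (act t w) w / U l\<^sub>2 t (act t w) w / arm_pot t (act t w) w"
    have c: "0 \<le> c" "c \<le> 1" using sub_weight_frac[of t "act t w" w] by (auto simp: c_def)
    have "(1 - opt_pot t w) * (sub_pot t w * c) \<le> (1 - opt_pot t w) * (sub_pot t w * 1)"
      using goodD[OF True, of t] assms c sub_pot_pos[of t w] by (intro mult_left_mono) auto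
    moreover have "sub_weight t w = (if act t w = y then 0 else (1 - opt_pot t w) * (sub_pot t w * c))"
      using True by (simp add: sub_weight_def c_def)
    ultimately show ?thesis
      using True opt_pot_pos[of t w] sub_pot_pos[of t w]
      by (auto simp: fail_pot_def opt_weight_def algebra_simps)
  qed (auto simp: fail_pot_def opt_weight_def sub_weight_def)
qed

text \<open>The potential is affine in \<open>opt_pot\<close> and in \<open>sub_pot\<close>
  separately, and a round changes only one of them while the factor belonging to the other stays
  positive.\<close>

lemma fail_pot_Suc_le:
  assumes "t \<ge> 1"
  shows "fail_pot (Suc t) w \<le> (fail_pot t w - opt_weight t w - sub_weight t w)
    + opt_weight t w * incr (- l\<^sub>1) t w + sub_weight t w * incr l\<^sub>2 t w"
proof (cases "good t w")
  case False
  then show ?thesis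
    by (simp add: fail_pot_def good_Suc opt_weight_def sub_weight_def)
next
  case True
  note g = goodD[OF True assms order_refl]
  let ?Q = "\<lambda>t. 1 - (1 - opt_pot t w) * (1 - sub_pot t w)"
  have fail: "fail_pot t w = ?Q t" using True by (simp add: fail_pot_def)
  show ?thesis
  proof (cases "act t w = y")
    case act: True
    have s: "sub_pot (Suc t) w = sub_pot t w" using sub_pot_Suc_eq[of t w] act assms by simp
    have "fail_pot (Suc t) w \<le> ?Q (Suc t)"
      using True g s mult_nonpos_nonneg[of "1 - opt_pot (Suc t) w" "1 - sub_pot t w"]
      by (auto simp: fail_pot_def good_Suc)
    then show ?thesis using True act opt_pot_Suc[OF assms, of w]
      by (simp add: fail opt_weight_def sub_weight_def s algebra_simps)
  next
    case act: False
    have o: "opt_pot (Suc t) w = opt_pot t w" using opt_pot_Suc[of t w] act assms by simp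
    define D where "D = sub_pot t w * (V l\<^sub>2 t (act t w) w / U l\<^sub>2 t (act t w) w) / arm_pot t (act t w) w"
    have "fail_pot (Suc t) w \<le> ?Q (Suc t)"
      using True g o mult_nonneg_nonpos[of "1 - opt_pot t w" "1 - sub_pot (Suc t) w"]
      by (auto simp: fail_pot_def good_Suc)
    also have "\<dots> \<le> 1 - (1 - opt_pot t w) * (1 - (sub_pot t w + D * (incr l\<^sub>2 t w - 1)))"
      unfolding o using g sub_pot_Suc_le[OF assms refl act]
      by (intro diff_left_mono mult_left_mono) (auto simp: D_def)
    finally have "fail_pot (Suc t) w
      \<le> 1 - (1 - opt_pot t w) * (1 - (sub_pot t w + D * (incr l\<^sub>2 t w - 1)))" .
    moreover have weights: "sub_weight t w = (1 - opt_pot t w) * D" "opt_weight t w = 0"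
      using True act by (simp_all add: sub_weight_def opt_weight_def D_def)
    ultimately show ?thesis
      unfolding fail weights by (simp add: algebra_simps)
  qed
qed

lemma measurable_potentials:
  assumes "s \<le> t"
  shows "opt_pot s \<in> borel_measurable (H t)" "arm_pot s x \<in> borel_measurable (H t)"
    "sub_pot s \<in> borel_measurable (H t)"
proof -
  note [measurable] = V_measurable_H[OF assms] U_measurable_H[OF assms]
  show "opt_pot s \<in> borel_measurable (H t)" unfolding opt_pot_def[abs_def] by measurable
  have [measurable]: "arm_pot s x \<in> borel_measurable (H t)" for x
    unfolding arm_pot_def[abs_def] by measurable
  show "arm_pot s x \<in> borel_measurable (H t)" by measurable
  show "sub_pot s \<in> borel_measurable (H t)" unfolding sub_pot_def[abs_def] by measurable
qed

lemma measurable_good: "Measurable.pred (H t) (good t)"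
proof -
  have [measurable]: "opt_pot s \<in> borel_measurable (H t)" "sub_pot s \<in> borel_measurable (H t)"
    if "s \<in> {1..t}" for s using that measurable_potentials by auto
  show ?thesis unfolding good_def[abs_def] by measurable
qed

lemma measurable_weights:
  assumes "t \<ge> 1"
  shows "fail_pot t \<in> borel_measurable (H t)" "opt_weight t \<in> borel_measurable (H t)"
    "sub_weight t \<in> borel_measurable (H t)"
proof -
  note [measurable] = measurable_potentials[OF order_refl] measurable_good
    V_measurable_H[OF order_refl] U_measurable_H[OF order_refl] act_measurable_H[OF assms order_refl]
  have [measurable]: "(\<lambda>w. V l\<^sub>2 t (act t w) w) \<in> borel_measurable (H t)"
    by (rule measurable_compose_countable) measurable
  have [measurable]: "(\<lambda>w. U l\<^sub>2 t (act t w) w) \<in> borel_measurable (H t)"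
    by (rule measurable_compose_countable) measurable
  have [measurable]: "(\<lambda>w. arm_pot t (act t w) w) \<in> borel_measurable (H t)"
    by (rule measurable_compose_countable) measurable
  show "fail_pot t \<in> borel_measurable (H t)" unfolding fail_pot_def[abs_def] by measurable
  show "opt_weight t \<in> borel_measurable (H t)" unfolding opt_weight_def[abs_def] by measurable
  show "sub_weight t \<in> borel_measurable (H t)" unfolding sub_weight_def[abs_def] by measurable
qed

text \<open>The bound on the next value splits into three nonnegative parts, so no integrability has
  to be shown. Both increments are integrated against weights known before the reward.\<close>

lemma nn_integral_fail_pot_Suc_le:
  assumes "t \<ge> 1"
  shows "(\<integral>\<^sup>+ w. fail_pot (Suc t) w \<partial>M) \<le> (\<integral>\<^sup>+ w. fail_pot t w \<partial>M)"
proof -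
  note mH [measurable] = measurable_weights[OF assms]
  note [measurable] = mH[THEN measurable_from_subalg[OF subalgebra_H]]
  let ?rest = "\<lambda>w. fail_pot t w - opt_weight t w - sub_weight t w"
  have incr_nonneg: "incr l t w \<ge> 0" for l w by (simp add: incr_def)
  note nonneg = weights_nonneg[OF assms]
  have rest: "?rest w \<ge> 0" for w using nonneg(3)[of w] by simp
  have "(\<integral>\<^sup>+ w. fail_pot (Suc t) w \<partial>M) \<le> (\<integral>\<^sup>+ w. ennreal (?rest w)
      + ennreal (incr (- l\<^sub>1) t w) * ennreal (opt_weight t w)
      + ennreal (incr l\<^sub>2 t w) * ennreal (sub_weight t w) \<partial>M)"
  proof (rule nn_integral_mono)
    fix w
    have "ennreal (fail_pot (Suc t) w) \<le> ennreal (?rest w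
      + incr (- l\<^sub>1) t w * opt_weight t w + incr l\<^sub>2 t w * sub_weight t w)"
      using fail_pot_Suc_le[OF assms, of w] by (intro ennreal_leI) (simp add: mult.commute)
    then show "ennreal (fail_pot (Suc t) w) \<le> ennreal (?rest w)
      + ennreal (incr (- l\<^sub>1) t w) * ennreal (opt_weight t w)
      + ennreal (incr l\<^sub>2 t w) * ennreal (sub_weight t w)"
      using rest[of w] nonneg[of w] incr_nonneg by (simp add: ennreal_plus ennreal_mult)
  qed
  also have "\<dots> = (\<integral>\<^sup>+ w. ?rest w \<partial>M)
      + (\<integral>\<^sup>+ w. ennreal (incr (- l\<^sub>1) t w) * ennreal (opt_weight t w) \<partial>M)
      + (\<integral>\<^sup>+ w. ennreal (incr l\<^sub>2 t w) * ennreal (sub_weight t w) \<partial>M)"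
    by (simp add: nn_integral_add)
  also have "\<dots> \<le> (\<integral>\<^sup>+ w. ?rest w \<partial>M) + (\<integral>\<^sup>+ w. opt_weight t w \<partial>M) + (\<integral>\<^sup>+ w. sub_weight t w \<partial>M)"
    using assms by (intro add_mono order_refl nn_integral_incr_le) measurable
  also have "\<dots> = (\<integral>\<^sup>+ w. ennreal (?rest w) + ennreal (opt_weight t w) + ennreal (sub_weight t w) \<partial>M)"
    by (simp add: nn_integral_add)
  also have "\<dots> = (\<integral>\<^sup>+ w. fail_pot t w \<partial>M)"
  proof (rule nn_integral_cong)
    fix w
    have "ennreal (?rest w) + ennreal (opt_weight t w) + ennreal (sub_weight t w)
      = ennreal (?rest w + opt_weight t w + sub_weight t w)"
      using rest[of w] nonneg(1,2)[of w] by (simp only: ennreal_plus add_nonneg_nonneg)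
    then show "ennreal (?rest w) + ennreal (opt_weight t w) + ennreal (sub_weight t w)
      = ennreal (fail_pot t w)"
      by simp
  qed
  finally show ?thesis .
qed

lemma good_measurable [measurable]: "Measurable.pred M (good t)"
  using measurable_from_subalg[OF subalgebra_H measurable_good] .

text \<open>At time 1 nothing has been pulled: every process and every maximum is 1, so each
  \<open>arm_pot\<close> is 2 and the potential starts at the right-hand side. Its expectation never
  grows and dominates the failure probability.\<close>

lemma prob_not_good_le:
  assumes "q * 2 ^ (CARD('a) - 1) < 1" "p < 1" "T \<ge> 1"
  shows "prob {w \<in> space M. \<not> good T w} \<le> 1 - (1 - p) * (1 - q * 2 ^ (CARD('a) - 1))"
proof -
  let ?q = "q * 2 ^ (CARD('a) - 1)"
  have V1: "V l (Suc 0) x w = 1" for l x w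
    by (simp add: exp_mart_def noise_sum_def pulls_def)
  have o: "opt_pot 1 w = p" and s: "sub_pot 1 w = ?q" for w
    by (simp_all add: opt_pot_def sub_pot_def arm_pot_def V1 card_Diff_singleton)
  have good1: "good 1 w" for w
    using assms o s by (simp add: good_def)
  have fail1: "fail_pot 1 w = 1 - (1 - p) * (1 - ?q)" for w
    unfolding fail_pot_def o s using good1[of w] by simp
  have "(\<integral>\<^sup>+ w. fail_pot T w \<partial>M) \<le> (\<integral>\<^sup>+ w. fail_pot 1 w \<partial>M)"
    using assms(3)
    by (induction T rule: dec_induct) (auto intro: order_trans[OF nn_integral_fail_pot_Suc_le])
  also have "\<dots> = ennreal (1 - (1 - p) * (1 - ?q))"
    unfolding fail1 by (simp add: emeasure_space_1 del: One_nat_def)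
  finally have *: "(\<integral>\<^sup>+ w. fail_pot T w \<partial>M) \<le> ennreal (1 - (1 - p) * (1 - ?q))" .
  have "emeasure M {w \<in> space M. \<not> good T w} = (\<integral>\<^sup>+ w. indicator {w \<in> space M. \<not> good T w} w \<partial>M)"
    by simp
  also have "\<dots> \<le> (\<integral>\<^sup>+ w. fail_pot T w \<partial>M)"
    by (intro nn_integral_mono) (auto simp: fail_pot_def indicator_def)
  also note *
  finally have "ennreal (prob {w \<in> space M. \<not> good T w}) \<le> ennreal (1 - (1 - p) * (1 - ?q))"
    by (simp add: emeasure_eq_measure)
  moreover have "1 - (1 - p) * (1 - ?q) \<ge> 0"
    using assms p_pos q_pos mult_le_one[of "1 - p" "1 - ?q"] by simp
  ultimately show ?thesis by (simp add: ennreal_le_iff)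
qed

text \<open>These are logarithms of \<open>opt_pot s w < 1\<close>, of the bound by the running
  maximum (the factor 2 undoes the square root), and of \<open>sub_pot T w < 1\<close> with each
  \<open>arm_pot\<close> at least its \<open>U\<close>. As \<open>U\<close> is taken at
  \<open>T\<close>, the second bound may be used at a random time \<open>s\<close>.\<close>

lemma good_bounds:
  assumes "good T w" "1 \<le> s" "s \<le> T"
  shows "- l\<^sub>1 * noise_sum r act R s y w \<le> l\<^sub>1\<^sup>2 * \<sigma>\<^sup>2 / 2 * pulls act s y w - ln p"
    and "l\<^sub>2 * noise_sum r act R s x w \<le> l\<^sub>2\<^sup>2 * \<sigma>\<^sup>2 / 2 * pulls act s x w + 2 * ln (U l\<^sub>2 T x w)"
    and "(\<Sum>x\<in>UNIV - {y}. ln (U l\<^sub>2 T x w)) \<le> - ln q"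
proof -
  have "ln p + ln (V (- l\<^sub>1) s y w) = ln (opt_pot s w)"
    using p_pos by (simp add: opt_pot_def ln_mult)
  also have "\<dots> \<le> 0"
    using goodD[OF assms] opt_pot_pos[of s w] by simp
  finally show "- l\<^sub>1 * noise_sum r act R s y w \<le> l\<^sub>1\<^sup>2 * \<sigma>\<^sup>2 / 2 * pulls act s y w - ln p"
    by (simp add: exp_mart_def)
  have "ln (sqrt (V l\<^sub>2 s x w)) \<le> ln (U l\<^sub>2 T x w)"
    using sqrt_exp_mart_le_peak[OF assms(3)] exp_mart_pos by (intro ln_mono) auto
  then have "ln (V l\<^sub>2 s x w) \<le> 2 * ln (U l\<^sub>2 T x w)"
    using exp_mart_pos by (simp add: ln_sqrt)
  then show "l\<^sub>2 * noise_sum r act R s x w \<le> l\<^sub>2\<^sup>2 * \<sigma>\<^sup>2 / 2 * pulls act s x w + 2 * ln (U l\<^sub>2 T x w)"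
    by (simp add: exp_mart_def)
  have "q * (\<Prod>x\<in>UNIV - {y}. U l\<^sub>2 T x w) \<le> sub_pot T w"
    unfolding sub_pot_def using q_pos
    by (intro mult_left_mono prod_mono) (auto simp: arm_pot_def less_imp_le)
  also have "\<dots> \<le> 1" using goodD[OF assms(1), of T] assms by simp
  finally have "ln (q * (\<Prod>x\<in>UNIV - {y}. U l\<^sub>2 T x w)) \<le> 0"
    using q_pos by (subst ln_le_zero_iff) (auto intro!: mult_pos_pos prod_pos)
  then show "(\<Sum>x\<in>UNIV - {y}. ln (U l\<^sub>2 T x w)) \<le> - ln q"
    using q_pos peak_pos by (simp add: ln_mult ln_prod prod_pos less_imp_neq[THEN not_sym])
qed

end

end

subsection \<open>Regret on the good event\<close>

lemma gap_nonneg: "gap r x \<ge> 0"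
  by (simp add: gap_def)

lemma sum_pulls: "(\<Sum>x\<in>UNIV. pulls act (Suc T) x w) = T" for act :: "nat \<Rightarrow> 'w \<Rightarrow> 'a::finite"
proof -
  have "(\<Sum>x\<in>UNIV. pulls act (Suc T) x w) = card (\<Union>x. {i \<in> {1..<Suc T}. act i w = x})"
    unfolding pulls_def by (subst card_UN_disjoint) auto
  also have "(\<Union>x. {i \<in> {1..<Suc T}. act i w = x}) = {1..<Suc T}" by auto
  finally show ?thesis by simp
qed

lemma regret_eq_sum_pulls: "regret r act T w = (\<Sum>x\<in>UNIV. pulls act (Suc T) x w * gap r x)"
proof (induction T)
  case 0
  then show ?case by (simp add: regret_def pulls_def)
next
  case (Suc T)
  have "(\<Sum>x\<in>UNIV. pulls act (Suc (Suc T)) x w * gap r x)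
    = (\<Sum>x\<in>UNIV. pulls act (Suc T) x w * gap r x + (if act (Suc T) w = x then gap r x else 0))"
    by (intro sum.cong) (auto simp: pulls_Suc algebra_simps)
  also have "\<dots> = regret r act (Suc T) w"
    using Suc by (simp add: sum.distrib regret_def)
  finally show ?case by simp
qed

lemma last_pull_exists:
  assumes "pulls act (Suc T) x w \<ge> 1"
  shows "\<exists>t\<in>{1..T}. act t w = x \<and> pulls act (Suc T) x w = Suc (pulls act t x w)"
  using assms
proof (induction T)
  case 0
  then show ?case by (simp add: pulls_def)
next
  case (Suc T)
  show ?case
  proof (cases "act (Suc T) w = x")
    case True
    then show ?thesis by (intro bexI[of _ "Suc T"]) (auto simp: pulls_Suc)
  next
    case False
    then have "pulls act (Suc (Suc T)) x w = pulls act (Suc T) x w"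
      by (simp add: pulls_Suc)
    with Suc show ?thesis by fastforce
  qed
qed

lemma emp_mean_eq:
  assumes "pulls act t x w \<ge> 1"
  shows "emp_mean act R t x w = r x + noise_sum r act R t x w / pulls act t x w"
proof -
  have "(\<Sum>i\<in>{1..<t}. if act i w = x then R i w else 0)
    = noise_sum r act R t x w + (\<Sum>i\<in>{1..<t}. if act i w = x then r x else 0)"
    unfolding noise_sum_def sum.distrib[symmetric] by (intro sum.cong) auto
  also have "(\<Sum>i\<in>{1..<t}. if act i w = x then r x else 0) = r x * pulls act t x w"
    by (simp add: pulls_def sum.If_cases Int_def)
  finally show ?thesis
    using assms by (simp add: emp_mean_def add_divide_distrib)
qed

text \<open>A positive count keeps the second bonus term infinite, so the minimum is the first
  one.\<close>

lemma eqo_index_inverse_bonus: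
  assumes "pulls act t x w \<ge> 1"
  shows "eqo_index (\<lambda>_. ereal c) (\<lambda>_. \<infinity>) act R t x w
    = ereal (emp_mean act R t x w + c / pulls act t x w)"
  using assms by (simp add: eqo_index_def)

lemma pulls_ge_1_if_bij:
  fixes act :: "nat \<Rightarrow> 'w \<Rightarrow> 'a::finite"
  assumes "bij_betw (\<lambda>t. act t w) {1..CARD('a)} UNIV" "t > CARD('a)"
  shows "pulls act t x w \<ge> 1"
proof -
  obtain i where "i \<in> {1..CARD('a)}" "act i w = x"
    using assms(1) unfolding bij_betw_def by (metis UNIV_I imageE)
  then have "i \<in> {i \<in> {1..<t}. act i w = x}" using assms(2) by auto
  then have "{i \<in> {1..<t}. act i w = x} \<noteq> {}" by blast
  then have "pulls act t x w > 0" unfolding pulls_def by (subst card_gt_0_iff) auto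
  then show ?thesis by simp
qed

section \<open>Pull counts and regret under quasi-optimism\<close>

context subgaussian_bandit
begin

lemma pulls_mult_gap_le_if_good:
  fixes y :: 'a and T :: nat
  assumes eqo: "eqo_plus_bandit M (\<lambda>_. ereal c) (\<lambda>_. \<infinity>) act R" and w: "w \<in> space M"
    and y: "r y = Max (range r)" and c: "c > 0"
    and l: "l\<^sub>1 > 0" "l\<^sub>2 > 0" and p: "p > 0" "- ln p = l\<^sub>1 * c" and q: "q > 0"
    and good: "good y l\<^sub>1 l\<^sub>2 p q (Suc T) w"
  shows "pulls act (Suc T) x w * gap r x
    \<le> gap r x + c + pulls act (Suc T) x w * ((l\<^sub>1 + l\<^sub>2) * \<sigma>\<^sup>2 / 2) + 2 / l\<^sub>2 * ln (U l\<^sub>2 (Suc T) x w)"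
proof -
  let ?m = "pulls act (Suc T) x w"
  have lnU: "ln (U l\<^sub>2 (Suc T) x w) \<ge> 0" using peak_ge_1 by (intro ln_ge_zero)
  have rhs: "0 \<le> c + ?m * ((l\<^sub>1 + l\<^sub>2) * \<sigma>\<^sup>2 / 2) + 2 / l\<^sub>2 * ln (U l\<^sub>2 (Suc T) x w)"
    using c l lnU by (intro add_nonneg_nonneg mult_nonneg_nonneg) auto
  \<comment> \<open>Up to one pull is paid for by the summand \<open>gap r x\<close>. Two pulls
    guarantee an earlier one before the last, so that the empirical mean of \<open>x\<close> is
    meaningful there.\<close>
  consider "?m = 0" | "?m = 1" | "?m \<ge> 2" by linarith
  then show ?thesis
  proof cases
    case 1
    then show ?thesis using rhs gap_nonneg[of r x] by simp
  next
    case 2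
    then show ?thesis using rhs by simp
  next
    case 3
    then have "?m \<ge> 1" by simp
    from last_pull_exists[OF this] obtain t
      where t: "1 \<le> t" "t \<le> T" "act t w = x" and m: "?m = Suc (pulls act t x w)" by auto
    define n where "n = pulls act t x w"
    have n: "n \<ge> 1" "?m = Suc n" using m 3 by (auto simp: n_def)
    have bij: "bij_betw (\<lambda>t. act t w) {1..CARD('a)} (UNIV :: 'a set)"
      and index: "\<And>t x. t > CARD('a) \<Longrightarrow> eqo_index (\<lambda>_. ereal c) (\<lambda>_. \<infinity>) act R t x w
        \<le> eqo_index (\<lambda>_. ereal c) (\<lambda>_. \<infinity>) act R t (act t w) w"
      using eqo w by (auto simp: eqo_plus_bandit_def)
    \<comment> \<open>The initial rounds play no arm twice, but \<open>x\<close> was already played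
      before \<open>t\<close>.\<close>
    have "t > CARD('a)"
    proof (rule ccontr)
      assume "\<not> t > CARD('a)"
      moreover have "{i \<in> {1..<t}. act i w = x} \<noteq> {}"
        using n(1) unfolding n_def pulls_def by (metis card.empty not_one_le_zero)
      then obtain i where "i \<in> {1..<t}" "act i w = x" by auto
      ultimately show False
        using bij t inj_onD[of "\<lambda>t. act t w" "{1..CARD('a)}" i t] by (auto simp: bij_betw_def)
    qed
    define n' where "n' = pulls act t y w"
    have n': "n' \<ge> 1" unfolding n'_def by (rule pulls_ge_1_if_bij) fact+
    let ?S = "\<lambda>x. noise_sum r act R t x w"
    have "r y + (?S y + c) / n' \<le> r x + (?S x + c) / n"
      using index[OF \<open>t > CARD('a)\<close>, of y] n(1) n' unfolding t(3)
      by (simp add: eqo_index_inverse_bonus emp_mean_eq[where r = r] n_def[symmetric] n'_def[symmetric]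
          add_divide_distrib)
    \<comment> \<open>Since \<open>- ln p = l\<^sub>1 * c\<close>, the bonus of \<open>y\<close>
      absorbs the logarithmic term exactly, and the remaining deficit does not depend on
      \<open>n'\<close>.\<close>
    moreover have "(?S y + c) / n' \<ge> - (l\<^sub>1 * \<sigma>\<^sup>2 / 2)"
    proof -
      have "- l\<^sub>1 * ?S y \<le> l\<^sub>1\<^sup>2 * \<sigma>\<^sup>2 / 2 * n' + l\<^sub>1 * c"
        using good_bounds(1)[OF p(1) q good, of t] t p(2) by (simp add: n'_def)
      then have "l\<^sub>1 * (- ?S y) \<le> l\<^sub>1 * (l\<^sub>1 * \<sigma>\<^sup>2 / 2 * n' + c)"
        by (simp add: algebra_simps power2_eq_square)
      then have "- ?S y \<le> l\<^sub>1 * \<sigma>\<^sup>2 / 2 * n' + c" using l(1) by (simp only: mult_le_cancel_left_pos)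
      then show ?thesis using n' by (simp add: field_simps)
    qed
    ultimately have "gap r x \<le> (?S x + c) / n + l\<^sub>1 * \<sigma>\<^sup>2 / 2"
      using y by (simp add: gap_def)
    then have "n * gap r x \<le> ?S x + c + n * (l\<^sub>1 * \<sigma>\<^sup>2 / 2)"
      using n(1) by (simp add: field_simps)
    moreover have "?S x \<le> n * (l\<^sub>2 * \<sigma>\<^sup>2 / 2) + 2 / l\<^sub>2 * ln (U l\<^sub>2 (Suc T) x w)"
    proof -
      have "l\<^sub>2 * ?S x \<le> l\<^sub>2\<^sup>2 * \<sigma>\<^sup>2 / 2 * n + 2 * ln (U l\<^sub>2 (Suc T) x w)"
        using good_bounds(2)[OF p(1) q good, of t] t by (simp add: n_def)
      also have "\<dots> = l\<^sub>2 * (n * (l\<^sub>2 * \<sigma>\<^sup>2 / 2) + 2 / l\<^sub>2 * ln (U l\<^sub>2 (Suc T) x w))"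
        using l(2) by (simp add: field_simps power2_eq_square)
      finally show ?thesis using l(2) by (simp only: mult_le_cancel_left_pos)
    qed
    moreover have "n * ((l\<^sub>1 + l\<^sub>2) * \<sigma>\<^sup>2 / 2) \<le> ?m * ((l\<^sub>1 + l\<^sub>2) * \<sigma>\<^sup>2 / 2)"
      using n(2) l by (intro mult_right_mono) auto
    ultimately show ?thesis
      unfolding n(2) by (simp add: algebra_simps add_divide_distrib)
  qed
qed

text \<open>The arm \<open>y\<close> has gap 0, so the bonus is paid for the other arms only; their
  pulls number at most \<open>T\<close>, and the logarithms of their maxima sum to at most
  \<open>- ln q\<close>.\<close>

lemma regret_le_if_good:
  fixes y :: 'a and T :: nat
  assumes eqo: "eqo_plus_bandit M (\<lambda>_. ereal c) (\<lambda>_. \<infinity>) act R" and w: "w \<in> space M"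
    and y: "r y = Max (range r)" and c: "c > 0"
    and l: "l\<^sub>1 > 0" "l\<^sub>2 > 0" and p: "p > 0" "- ln p = l\<^sub>1 * c" and q: "q > 0"
    and good: "good y l\<^sub>1 l\<^sub>2 p q (Suc T) w"
  shows "regret r act T w \<le> (\<Sum>x\<in>UNIV. gap r x) + (real CARD('a) - 1) * c
    + T * ((l\<^sub>1 + l\<^sub>2) * \<sigma>\<^sup>2 / 2) - 2 / l\<^sub>2 * ln q"
proof -
  let ?s = "(l\<^sub>1 + l\<^sub>2) * \<sigma>\<^sup>2 / 2"
  let ?N = "\<lambda>x. real (pulls act (Suc T) x w)"
  have gap_y: "gap r y = 0" using y by (simp add: gap_def)
  have split: "(\<Sum>x\<in>UNIV. f x) = f y + (\<Sum>x\<in>UNIV - {y}. f x)" for f :: "'a \<Rightarrow> real"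
    by (intro sum.remove) auto
  have "regret r act T w = (\<Sum>x\<in>UNIV - {y}. ?N x * gap r x)"
    by (simp add: regret_eq_sum_pulls split gap_y)
  also have "\<dots> \<le> (\<Sum>x\<in>UNIV - {y}. gap r x + c + ?N x * ?s + 2 / l\<^sub>2 * ln (U l\<^sub>2 (Suc T) x w))"
    by (intro sum_mono pulls_mult_gap_le_if_good[OF assms])
  also have "\<dots> = (\<Sum>x\<in>UNIV - {y}. gap r x) + (real CARD('a) - 1) * c
      + (\<Sum>x\<in>UNIV - {y}. ?N x) * ?s + 2 / l\<^sub>2 * (\<Sum>x\<in>UNIV - {y}. ln (U l\<^sub>2 (Suc T) x w))"
    by (simp add: sum.distrib sum_distrib_left sum_distrib_right card_Diff_singleton of_nat_diff
        del: peak.simps)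
  also have "\<dots> \<le> (\<Sum>x\<in>UNIV - {y}. gap r x) + (real CARD('a) - 1) * c + T * ?s + 2 / l\<^sub>2 * (- ln q)"
  proof (intro add_mono order_refl mult_left_mono mult_right_mono)
    have "(\<Sum>x\<in>UNIV. ?N x) = T" unfolding of_nat_sum[symmetric] sum_pulls ..
    then show "(\<Sum>x\<in>UNIV - {y}. ?N x) \<le> T" by (simp add: split)
    show "(\<Sum>x\<in>UNIV - {y}. ln (U l\<^sub>2 (Suc T) x w)) \<le> - ln q"
      using good_bounds(3)[OF p(1) q good, of "Suc T"] by simp
  qed (use l in auto)
  finally show ?thesis by (simp add: split gap_y)
qed

end

section \<open>Choice of constants and the final bound\<close>

lemma failure_prob_le:
  fixes \<delta> q :: real and k :: nat
  assumes \<delta>: "0 < \<delta>" "\<delta> < 1" and k: "k \<ge> 1"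
    and q: "q = exp (- ((k + 3) / 4 * ln (8 * (1 + \<delta>) / \<delta>)))"
  shows "q * 2 ^ k < 1" "1 - (1 - \<delta> * (1 + \<delta>) / 2) * (1 - q * 2 ^ k) \<le> \<delta>"
proof -
  define B where "B = 8 * (1 + \<delta>) / \<delta>"
  have B: "B \<ge> 16" using \<delta> by (simp add: B_def field_simps)
  have "4 * ln 2 = ln (2 ^ 4 :: real)" by (subst ln_realpow) auto
  also have "\<dots> \<le> ln B" using B by (intro ln_mono) auto
  finally have lnB: "ln 2 \<le> ln B / 4" by simp
  \<comment> \<open>\<open>q\<close> is 1/B times the power k - 1 of B^(-1/4). As B is at least 16,
    each such factor absorbs one factor 2, which leaves 2/B.\<close>
  have "(real k - 1) * ln 2 \<le> (real k - 1) * (ln B / 4)"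
    using lnB k by (intro mult_left_mono) auto
  then have "- ((k + 3) / 4 * ln B) + k * ln 2 \<le> ln 2 - ln B"
    by (simp add: field_simps)
  moreover have "q * 2 ^ k = exp (- ((k + 3) / 4 * ln B) + k * ln 2)"
    unfolding q B_def[symmetric] exp_add by (simp add: exp_of_nat_mult)
  moreover have "exp (ln 2 - ln B) = 2 / B" using B by (simp add: exp_diff)
  ultimately have le: "q * 2 ^ k \<le> 2 / B" by (metis exp_le_cancel_iff)
  also have "\<dots> < 1" using B by simp
  finally show "q * 2 ^ k < 1" .
  \<comment> \<open>The fraction comes from 1 - p = (1 - \<delta>)(2 + \<delta>)/2 and 1 - 2/B = (4
    + 3\<delta>)/(4(1 + \<delta>)).\<close>
  have "1 - \<delta> \<le> (1 - \<delta>) * ((2 + \<delta>) * (4 + 3 * \<delta>) / (8 * (1 + \<delta>)))"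
  proof -
    have "1 \<le> (2 + \<delta>) * (4 + 3 * \<delta>) / (8 * (1 + \<delta>))"
      using \<delta> by (simp add: field_simps)
    from mult_left_mono[OF this, of "1 - \<delta>"] show ?thesis using \<delta> by simp
  qed
  also have "\<dots> = (1 - \<delta> * (1 + \<delta>) / 2) * (1 - 2 / B)"
    using \<delta> by (simp add: B_def divide_simps) (simp add: algebra_simps)
  also have "\<dots> \<le> (1 - \<delta> * (1 + \<delta>) / 2) * (1 - q * 2 ^ k)"
    using le \<delta> mult_le_one[of \<delta> \<delta>] by (intro mult_left_mono) (auto simp: algebra_simps)
  finally show "1 - (1 - \<delta> * (1 + \<delta>) / 2) * (1 - q * 2 ^ k) \<le> \<delta>" by simp
qed

lemma (in subgaussian_bandit) prob_regret_gt_le: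
  assumes eqo: "eqo_plus_bandit M (\<lambda>_. ereal c) (\<lambda>_. \<infinity>) act R" and c: "c > 0"
    and \<delta>: "0 < \<delta>" "\<delta> < 1" and card: "CARD('a) \<ge> 2"
  shows "prob {w \<in> space M. regret r act T w > \<sigma>\<^sup>2 * real T * ln (4 / \<delta>) / c
    + 3 / 2 * c * real CARD('a) + (\<Sum>x\<in>UNIV. gap r x)} \<le> \<delta>"
    (is "prob {w \<in> space M. regret r act T w > ?b} \<le> _")
proof -
  obtain y where y: "r y = Max (range r)"
    using Max_in[of "range r"] by (metis finite UNIV_not_empty empty_is_image finite_imageI imageE)
  define k where "k = CARD('a) - 1"
  have k: "k \<ge> 1" "real CARD('a) = k + 1" using card by (auto simp: k_def of_nat_diff)
  define p where "p = \<delta> * (1 + \<delta>) / 2"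
  define l\<^sub>1 where "l\<^sub>1 = - ln p / c"
  define l\<^sub>2 where "l\<^sub>2 = ln (8 * (1 + \<delta>) / \<delta>) / c"
  \<comment> \<open>With this exponent the term from \<open>q\<close> is (k + 3) c / 2; adding the k
    bonuses c gives 3 (k + 1) c / 2, exactly the arm term of the claim.\<close>
  define q where "q = exp (- ((k + 3) / 4 * ln (8 * (1 + \<delta>) / \<delta>)))"
  have p: "p > 0" "p < 1"
    using \<delta> mult_strict_mono[of \<delta> 1 "1 + \<delta>" 2] by (auto simp: p_def)
  have q: "q > 0" by (simp add: q_def)
  have l1: "l\<^sub>1 > 0" using p c by (simp add: l\<^sub>1_def divide_neg_pos)
  have "8 * (1 + \<delta>) / \<delta> > 1" using \<delta> by (simp add: field_simps)
  then have l2: "l\<^sub>2 > 0" using c unfolding l\<^sub>2_def by (intro divide_pos_pos ln_gt_zero)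
  have "ln (8 * (1 + \<delta>) / \<delta>) - ln p = ln (8 * (1 + \<delta>) / \<delta> / p)"
    using \<delta> p by (subst ln_div[of _ p]) auto
  \<comment> \<open>The factors 1 + \<delta> cancel, so the two exponents add up to
    \<open>2 * ln (4 / \<delta>) / c\<close>.\<close>
  also have "8 * (1 + \<delta>) / \<delta> / p = (4 / \<delta>) ^ 2"
    using \<delta> by (simp add: p_def divide_simps power2_eq_square)
  also have "ln ((4 / \<delta>) ^ 2) = 2 * ln (4 / \<delta>)"
    using \<delta> by (subst ln_realpow) auto
  finally have sum: "ln (8 * (1 + \<delta>) / \<delta>) - ln p = 2 * ln (4 / \<delta>)" .
  have l12: "l\<^sub>1 + l\<^sub>2 = 2 * ln (4 / \<delta>) / c"
    unfolding sum[symmetric] l\<^sub>1_def l\<^sub>2_def by (simp add: diff_divide_distrib)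
  have lnq: "2 / l\<^sub>2 * ln q = - ((k + 3) / 2 * c)"
    using l2 c by (simp add: q_def l\<^sub>2_def field_simps)
  have "regret r act T w \<le> ?b" if "w \<in> space M" "good y l\<^sub>1 l\<^sub>2 p q (Suc T) w" for w
  proof -
    have "regret r act T w \<le> (\<Sum>x\<in>UNIV. gap r x) + (real CARD('a) - 1) * c
      + T * ((l\<^sub>1 + l\<^sub>2) * \<sigma>\<^sup>2 / 2) - 2 / l\<^sub>2 * ln q"
      using c by (intro regret_le_if_good[OF eqo that(1) y c l1 l2 p(1) _ q that(2)]) (simp add: l\<^sub>1_def)
    also have "\<dots> = ?b"
      unfolding l12 lnq k(2) by (simp add: field_simps)
    finally show ?thesis .
  qed
  then have "{w \<in> space M. regret r act T w > ?b} \<subseteq> {w \<in> space M. \<not> good y l\<^sub>1 l\<^sub>2 p q (Suc T) w}"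
    by force
  moreover note [measurable] = good_measurable[OF p(1) q]
  ultimately have "prob {w \<in> space M. regret r act T w > ?b}
      \<le> prob {w \<in> space M. \<not> good y l\<^sub>1 l\<^sub>2 p q (Suc T) w}"
    by (intro finite_measure_mono) measurable
  \<comment> \<open>The potential is followed up to \<open>Suc T\<close>, which is at least 1 even
    for \<open>T = 0\<close>.\<close>
  also have "\<dots> \<le> 1 - (1 - p) * (1 - q * 2 ^ k)"
    using prob_not_good_le[OF p(1) q _ p(2), of "Suc T" y l\<^sub>1 l\<^sub>2] failure_prob_le(1)[OF \<delta> k(1) q_def]
    by (simp add: k_def)
  also have "\<dots> \<le> \<delta>"
    using failure_prob_le(2)[OF \<delta> k(1) q_def] by (simp add: p_def)
  finally show ?thesis .
qed

theorem theorem1: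
  fixes M :: "'w measure"
    and r :: "'a::finite \<Rightarrow> real"
    and act :: "nat \<Rightarrow> 'w \<Rightarrow> 'a"
    and R :: "nat \<Rightarrow> 'w \<Rightarrow> real"
    and \<sigma> c1 :: real
  assumes "prob_space M"
    and "\<sigma> \<ge> 0"
    and "\<And>x. 0 \<le> r x \<and> r x \<le> 1"
    and "\<And>t. act t \<in> measurable M (count_space UNIV)"
    and "\<And>t. R t \<in> borel_measurable M"
    and "cond_subgaussian M r \<sigma> act R"
    and "c1 > 0"
    and "eqo_plus_bandit M (\<lambda>_. ereal c1) (\<lambda>_. \<infinity>) act R"
  shows "\<forall>T::nat. \<forall>\<delta>::real. 0 < \<delta> \<and> \<delta> \<le> 1 \<longrightarrow>
           dist_regret M r act T \<delta>
             \<le> ereal (\<sigma>\<^sup>2 * real T * ln (4 / \<delta>) / c1 + 3 / 2 * c1 * real CARD('a)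
                      + (\<Sum>x\<in>UNIV. gap r x))"
proof (intro allI impI)
  fix T :: nat and \<delta> :: real
  assume \<delta>: "0 < \<delta> \<and> \<delta> \<le> 1"
  interpret subgaussian_bandit M r \<sigma> act R
    using assms by (simp add: subgaussian_bandit_def subgaussian_bandit_axioms_def)
  let ?b = "\<sigma>\<^sup>2 * real T * ln (4 / \<delta>) / c1 + 3 / 2 * c1 * real CARD('a) + (\<Sum>x\<in>UNIV. gap r x)"
  have "prob {w \<in> space M. regret r act T w > ?b} \<le> \<delta>"
  proof -
    \<comment> \<open>At \<delta> = 1 the choice of \<open>p\<close> would be 1 and
      \<open>l\<^sub>1\<close> would vanish, but the claim is trivial for a probability. With a
      single arm all gaps are 0.\<close>
    consider "\<delta> = 1" | "CARD('a) = 1" | "\<delta> < 1" "CARD('a) \<ge> 2"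
      using \<delta> zero_less_card_finite[where 'a = 'a] by linarith
    then show ?thesis
    proof cases
      case 2
      then obtain y where "(UNIV :: 'a set) = {y}" by (auto simp: card_1_singleton_iff)
      then have gap0: "gap r x = 0" for x
        by (metis Max_singleton UNIV_I diff_self gap_def image_empty image_insert singletonD)
      have "?b \<ge> 0"
        using \<delta> assms by (simp add: gap0)
      then show ?thesis
        using \<delta> by (simp add: regret_def gap0)
    qed (use prob_regret_gt_le assms \<delta> in auto)
  qed
  then show "dist_regret M r act T \<delta> \<le> ereal ?b"
    unfolding dist_regret_def by (intro Inf_lower) blast
qed

end
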